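(* Let $n\geq 1$. The operators $\pi_1,\ldots,\pi_{n-1}$ on the $\mathbb{C}$-vector space with basis all standard reverse composition tableaux (SRCTs) of size $n$ satisfy the same relations as the generators $T_1,\ldots,T_{n-1}$ of the $0$-Hecke algebra $H_n(0)$, namely \[\pi_i^2=\pi_i\ (1\leq i\leq n-1),\qquad \pi_i\pi_{i+1}\pi_i=\pi_{i+1}\pi_i\pi_{i+1}\ (1\leq i\leq n-2),\qquad \pi_i\pi_j=\pi_j\pi_i\ (|i-j|\geq 2),\] thus giving an $H_n(0)$-action on SRCTs of size $n$.
   Context: A composition $\alpha=(\alpha_1,\ldots,\alpha_k)$ of $n$ ($\alpha\vDash n$) is an ordered list of positive integers summing to $n$. Its reverse composition diagram is the array of left-justified cells with $\alpha_i$ cells in row $i$ from the top; $(i,j)$ is the cell in row $i$ from the top and column $j$ from the left. A standard reverse composition tableau (SRCT) of shape $\alpha\vDash n$ and size $n$ is a bijective filling $\tau:\alpha\to\{1,\ldots,n\}$ of the cells such that (1) entries in each row decrease from left to right; (2) entries in the first column increase from top to bottom; (3) (triple rule) if $i<j$ and $\tau(i,k)>\tau(j,k+1)$, then $\tau(i,k+1)$ exists and $\tau(i,k+1)>\tau(j,k+1)$. $\mathrm{SRCT}(\alpha)$ is the set of SRCTs of shape $\alpha$. The descent set is $\mathrm{Des}(\tau)=\{i\in[n-1] : i+1 \text{ appears weakly right of } i \text{ in }\tau\}$ (i.e. the column of $i+1$ has index at least that of $i$). For $1\leq i\leq n-1$, $i$ and $i+1$ are attacking in $\tau$ if either they are in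 the same column, or they are in adjacent columns with $i+1$ positioned strictly southeast of $i$ (i.e. $i+1$ is in the column immediately to the right of that of $i$, in a strictly lower row). Let $s_i(\tau)$ be the filling obtained by interchanging the positions of $i$ and $i+1$ in $\tau$ (if $i\in\mathrm{Des}(\tau)$ and $i,i+1$ are non-attacking, $s_i(\tau)$ is again an SRCT of the same shape). Define \[\pi_i(\tau)=\begin{cases}\tau & i\notin \mathrm{Des}(\tau)\\ 0 & i\in \mathrm{Des}(\tau),\ i \text{ and } i+1 \text{ attacking}\\ s_i(\tau) & i\in\mathrm{Des}(\tau),\ i\text{ and }i+1\text{ non-attacking}\end{cases}\] extended $\mathbb{C}$-linearly. The $0$-Hecke algebra $H_n(0)$ is the $\mathbb{C}$-algebra generated by $T_1,\ldots,T_{n-1}$ subject to $T_i^2=T_i$, $T_iT_{i+1}T_i=T_{i+1}T_iT_{i+1}$, and $T_iT_j=T_jT_i$ if $|i-j|\geq 2$. *)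

theory Defs
  imports
    Complex_Main
    "HOL-Library.Poly_Mapping"
    "HOL-Combinatorics.Transposition"
    "HOL-Algebra.QuotRing"
begin

section \<open>Standard reverse composition tableaux\<close>

definition compositions :: "nat \<Rightarrow> nat list set" where
  "compositions n = {\<alpha>. (\<forall>a\<in>set \<alpha>. 0 < a) \<and> sum_list \<alpha> = n}"

text \<open>Rows (from the top) and columns (from the left) are numbered from 0.\<close>

definition diagram :: "nat list \<Rightarrow> (nat \<times> nat) set" where
  "diagram \<alpha> = {(i, j). i < length \<alpha> \<and> j < \<alpha> ! i}"

text \<open>A filling of a diagram is the list of its rows, so that it determines its shape.\<close>

type_synonym filling = "nat list list"

definition shape :: "filling \<Rightarrow> nat list" where
  "shape \<tau> = map length \<tau>"

definition entry :: "filling \<Rightarrow> nat \<times> nat \<Rightarrow> nat" where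
  "entry \<tau> = (\<lambda>(i, j). \<tau> ! i ! j)"

definition SRCT :: "nat list \<Rightarrow> filling set" where
  "SRCT \<alpha> = {\<tau>. shape \<tau> = \<alpha> \<and>
     bij_betw (entry \<tau>) (diagram \<alpha>) {1..sum_list \<alpha>} \<and>
     (\<forall>i j k. (i, j) \<in> diagram \<alpha> \<and> (i, k) \<in> diagram \<alpha> \<and> j < k
        \<longrightarrow> entry \<tau> (i, k) < entry \<tau> (i, j)) \<and>
     (\<forall>i j. (i, 0) \<in> diagram \<alpha> \<and> (j, 0) \<in> diagram \<alpha> \<and> i < j
        \<longrightarrow> entry \<tau> (i, 0) < entry \<tau> (j, 0)) \<and>
     (\<forall>i j k. (i, k) \<in> diagram \<alpha> \<and> (j, Suc k) \<in> diagram \<alpha> \<and> i < j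
        \<and> entry \<tau> (j, Suc k) < entry \<tau> (i, k)
        \<longrightarrow> (i, Suc k) \<in> diagram \<alpha> \<and> entry \<tau> (j, Suc k) < entry \<tau> (i, Suc k))}"

definition SRCTs :: "nat \<Rightarrow> filling set" where
  "SRCTs n = (\<Union>\<alpha>\<in>compositions n. SRCT \<alpha>)"

definition cell_of :: "filling \<Rightarrow> nat \<Rightarrow> nat \<times> nat" where
  "cell_of \<tau> x = the_inv_into (diagram (shape \<tau>)) (entry \<tau>) x"

definition row_of :: "filling \<Rightarrow> nat \<Rightarrow> nat" where
  "row_of \<tau> x = fst (cell_of \<tau> x)"

definition col_of :: "filling \<Rightarrow> nat \<Rightarrow> nat" where
  "col_of \<tau> x = snd (cell_of \<tau> x)"

definition Des :: "filling \<Rightarrow> nat set" where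
  "Des \<tau> = {i \<in> {1..sum_list (shape \<tau>) - 1}. col_of \<tau> i \<le> col_of \<tau> (i + 1)}"

definition attacking :: "filling \<Rightarrow> nat \<Rightarrow> bool" where
  "attacking \<tau> i \<longleftrightarrow> col_of \<tau> i = col_of \<tau> (i + 1) \<or>
     (col_of \<tau> (i + 1) = col_of \<tau> i + 1 \<and> row_of \<tau> i < row_of \<tau> (i + 1))"

definition swap_entries :: "nat \<Rightarrow> filling \<Rightarrow> filling" where
  "swap_entries i \<tau> = map (map (Transposition.transpose i (i + 1))) \<tau>"


section \<open>The operators\<close>

definition scale :: "complex \<Rightarrow> ('a \<Rightarrow>\<^sub>0 complex) \<Rightarrow> ('a \<Rightarrow>\<^sub>0 complex)" where
  "scale c = Poly_Mapping.map ((*) c)"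

lemma lookup_scale [simp]: "Poly_Mapping.lookup (scale c v) x = c * Poly_Mapping.lookup v x"
  by (simp add: scale_def Poly_Mapping.map.rep_eq when_def)

global_interpretation poly_mapping_vs: vector_space "scale :: complex \<Rightarrow> ('a \<Rightarrow>\<^sub>0 complex) \<Rightarrow> _"
  by standard (auto intro!: poly_mapping_eqI simp: lookup_add algebra_simps)

text \<open>
  The vector space with basis the tableaux of size \<open>n\<close>; a tableau \<open>\<tau>\<close> is the basis
  vector \<open>Poly_Mapping.single \<tau> 1\<close>.
\<close>

definition SRCT_space :: "nat \<Rightarrow> (filling \<Rightarrow>\<^sub>0 complex) set" where
  "SRCT_space n = {v. Poly_Mapping.keys v \<subseteq> SRCTs n}"

definition pi_basis :: "nat \<Rightarrow> filling \<Rightarrow> (filling \<Rightarrow>\<^sub>0 complex)" where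
  "pi_basis i \<tau> =
     (if i \<notin> Des \<tau> then Poly_Mapping.single \<tau> 1
      else if attacking \<tau> i then 0
      else Poly_Mapping.single (swap_entries i \<tau>) 1)"

definition pi_op :: "nat \<Rightarrow> (filling \<Rightarrow>\<^sub>0 complex) \<Rightarrow> (filling \<Rightarrow>\<^sub>0 complex)" where
  "pi_op i v = (\<Sum>\<tau>\<in>Poly_Mapping.keys v. scale (Poly_Mapping.lookup v \<tau>) (pi_basis i \<tau>))"


section \<open>The 0-Hecke algebra\<close>

text \<open>
  Words under concatenation form a monoid, written additively because the convolution
  product on \<open>\<Rightarrow>\<^sub>0\<close> is; hence \<open>word \<Rightarrow>\<^sub>0 complex\<close> is the free
  associative algebra on generators indexed by \<open>nat\<close>.
\<close>

datatype word = Word (letters: "nat list")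

instantiation word :: monoid_add
begin

definition zero_word :: word where
  "0 = Word []"

definition plus_word :: "word \<Rightarrow> word \<Rightarrow> word" where
  "u + v = Word (letters u @ letters v)"

instance
  by standard (auto simp: zero_word_def plus_word_def)

end

definition free_algebra :: "nat \<Rightarrow> (word \<Rightarrow>\<^sub>0 complex) ring" where
  "free_algebra n =
     \<lparr>carrier = {p. \<forall>w\<in>Poly_Mapping.keys p. set (letters w) \<subseteq> {1..n - 1}},
      monoid.mult = (*), one = 1, zero = 0, add = (+)\<rparr>"

definition gen :: "nat \<Rightarrow> (word \<Rightarrow>\<^sub>0 complex)" where
  "gen i = Poly_Mapping.single (Word [i]) 1"

definition hecke_relators :: "nat \<Rightarrow> (word \<Rightarrow>\<^sub>0 complex) set" where
  "hecke_relators n =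
     {gen i * gen i - gen i | i. i \<in> {1..n - 1}} \<union>
     {gen i * gen (i + 1) * gen i - gen (i + 1) * gen i * gen (i + 1) | i. i \<in> {1..n - 2}} \<union>
     {gen i * gen j - gen j * gen i | i j.
        i \<in> {1..n - 1} \<and> j \<in> {1..n - 1} \<and> 2 \<le> \<bar>int i - int j\<bar>}"

definition hecke_ideal :: "nat \<Rightarrow> (word \<Rightarrow>\<^sub>0 complex) set" where
  "hecke_ideal n = genideal (free_algebra n) (hecke_relators n)"

definition Hecke :: "nat \<Rightarrow> (word \<Rightarrow>\<^sub>0 complex) set ring" where
  "Hecke n = free_algebra n Quot hecke_ideal n"

definition hecke_class :: "nat \<Rightarrow> (word \<Rightarrow>\<^sub>0 complex) \<Rightarrow> (word \<Rightarrow>\<^sub>0 complex) set" where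
  "hecke_class n p = hecke_ideal n +>\<^bsub>free_algebra n\<^esub> p"

definition hecke_T :: "nat \<Rightarrow> nat \<Rightarrow> (word \<Rightarrow>\<^sub>0 complex) set" where
  "hecke_T n i = hecke_class n (gen i)"

definition hecke_const :: "nat \<Rightarrow> complex \<Rightarrow> (word \<Rightarrow>\<^sub>0 complex) set" where
  "hecke_const n c = hecke_class n (Poly_Mapping.single 0 c)"

lemma ring_free_algebra: "ring (free_algebra n)"
proof (rule ringI)
  have neg: "p \<in> carrier (free_algebra n) \<Longrightarrow> - p \<in> carrier (free_algebra n)" for p
    by (auto simp: free_algebra_def in_keys_iff)
  show "abelian_group (free_algebra n)"
  proof (rule abelian_groupI)
    fix p assume "p \<in> carrier (free_algebra n)"
    then show "\<exists>q\<in>carrier (free_algebra n). q \<oplus>\<^bsub>free_algebra n\<^esub> p = \<zero>\<^bsub>free_algebra n\<^esub>"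
      using neg[of p] by (intro bexI[of _ "- p"]) (auto simp: free_algebra_def)
  qed (use keys_add in \<open>fastforce simp: free_algebra_def algebra_simps\<close>)+
  show "Group.monoid (free_algebra n)"
  proof (rule Group.monoidI)
    fix p q assume "p \<in> carrier (free_algebra n)" "q \<in> carrier (free_algebra n)"
    then show "p \<otimes>\<^bsub>free_algebra n\<^esub> q \<in> carrier (free_algebra n)"
      using keys_mult[of p q] by (fastforce simp: free_algebra_def plus_word_def)
  qed (auto simp: free_algebra_def zero_word_def mult.assoc)
qed (auto simp: free_algebra_def algebra_simps)

lemma hecke_relators_subset: "hecke_relators n \<subseteq> carrier (free_algebra n)"
proof -
  interpret ring "free_algebra n"
    by (rule ring_free_algebra)
  have gen: "i \<in> {1..n - 1} \<Longrightarrow> gen i \<in> carrier (free_algebra n)" for i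
    by (auto simp: free_algebra_def gen_def)
  have mult: "p \<in> carrier (free_algebra n) \<Longrightarrow> q \<in> carrier (free_algebra n)
      \<Longrightarrow> p * q \<in> carrier (free_algebra n)" for p q
    using m_closed[of p q] by (simp add: free_algebra_def)
  have diff: "p \<in> carrier (free_algebra n) \<Longrightarrow> q \<in> carrier (free_algebra n)
      \<Longrightarrow> p - q \<in> carrier (free_algebra n)" for p q
    using keys_diff[of p q] by (fastforce simp: free_algebra_def)
  show ?thesis
    unfolding hecke_relators_def by (auto intro!: diff mult gen)
qed

lemma ideal_hecke_ideal: "ideal (hecke_ideal n) (free_algebra n)"
  unfolding hecke_ideal_def
  by (rule ring.genideal_ideal[OF ring_free_algebra hecke_relators_subset])

lemma ring_Hecke: "ring (Hecke n)"
  unfolding Hecke_def by (rule ideal.quotient_is_ring[OF ideal_hecke_ideal])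

text \<open>
  A left module structure over the complex algebra \<open>Hecke n\<close> on a subspace \<open>V\<close>,
  whose underlying vector space structure is the given one.
\<close>

definition hecke_action ::
  "nat \<Rightarrow> ('a \<Rightarrow>\<^sub>0 complex) set \<Rightarrow>
   ((word \<Rightarrow>\<^sub>0 complex) set \<Rightarrow> ('a \<Rightarrow>\<^sub>0 complex) \<Rightarrow> ('a \<Rightarrow>\<^sub>0 complex)) \<Rightarrow> bool" where
  "hecke_action n V act \<longleftrightarrow>
     (\<forall>h\<in>carrier (Hecke n). \<forall>v\<in>V. act h v \<in> V) \<and>
     (\<forall>h\<in>carrier (Hecke n). \<forall>v\<in>V. \<forall>w\<in>V. act h (v + w) = act h v + act h w) \<and>
     (\<forall>h\<in>carrier (Hecke n). \<forall>c. \<forall>v\<in>V. act h (scale c v) = scale c (act h v)) \<and>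
     (\<forall>g\<in>carrier (Hecke n). \<forall>h\<in>carrier (Hecke n). \<forall>v\<in>V.
        act (g \<oplus>\<^bsub>Hecke n\<^esub> h) v = act g v + act h v) \<and>
     (\<forall>g\<in>carrier (Hecke n). \<forall>h\<in>carrier (Hecke n). \<forall>v\<in>V.
        act (g \<otimes>\<^bsub>Hecke n\<^esub> h) v = act g (act h v)) \<and>
     (\<forall>c. \<forall>v\<in>V. act (hecke_const n c) v = scale c v) \<and>
     (\<forall>v\<in>V. act \<one>\<^bsub>Hecke n\<^esub> v = v)"

end

(*
Each operator acts on the triple of cells of i, i + 1, i + 2 by sorting two of them into decreasing
column order or by killing the tableau, so the relations are a case distinction on the columns of
these cells and do not involve the tableau axioms. Those are needed only to see that a swap at a
non-attacking descent gives a tableau again. For the action, the free algebra acts through words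
in the operators; the elements that annihilate the space form an ideal containing the relators.
*)

theory Submission
  imports Defs
begin

section \<open>Linear extension\<close>

text \<open>Updating a fresh key is the same as adding a monomial. The step drops the freshness of
  \<open>k\<close>, which suits statements additive in \<open>p\<close>.\<close>

lemma poly_mapping_induct_add [case_names zero add]:
  assumes "P 0" and "\<And>k c p. P p \<Longrightarrow> P (Poly_Mapping.single k c + p)"
  shows "P p"
proof (induction p rule: update_induct)
  case const
  show ?case by (rule assms(1))
next
  case (update p k c)
  have "Poly_Mapping.update k c p = Poly_Mapping.single k c + p"
    using update.hyps
    by (intro poly_mapping_eqI)
      (auto simp: lookup_update lookup_add lookup_single when_def in_keys_iff)
  then show ?case
    using assms(2)[OF update.IH] by simp
qed

definition lin_ext :: "('a \<Rightarrow> ('b \<Rightarrow>\<^sub>0 complex)) \<Rightarrow> ('a \<Rightarrow>\<^sub>0 complex) \<Rightarrow> ('b \<Rightarrow>\<^sub>0 complex)" where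
  "lin_ext f v = (\<Sum>k\<in>Poly_Mapping.keys v. scale (Poly_Mapping.lookup v k) (f k))"

text \<open>Keys can cancel in a sum, so additivity is proved by summing over one finite set that
  contains the supports of both summands and of their sum.\<close>

lemma lin_ext_superset:
  assumes "finite A" "Poly_Mapping.keys v \<subseteq> A"
  shows "lin_ext f v = (\<Sum>k\<in>A. scale (Poly_Mapping.lookup v k) (f k))"
  unfolding lin_ext_def using assms
  by (intro sum.mono_neutral_left) (auto simp: in_keys_iff)

lemma keys_scale: "Poly_Mapping.keys (scale c v) \<subseteq> Poly_Mapping.keys v"
  by (auto simp: in_keys_iff)

lemma linear_lin_ext: "Vector_Spaces.linear scale scale (lin_ext f)"
proof -
  have "lin_ext f (v + w) = lin_ext f v + lin_ext f w" for v w
  proof -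
    let ?A = "Poly_Mapping.keys v \<union> Poly_Mapping.keys w"
    have "finite ?A" "Poly_Mapping.keys (v + w) \<subseteq> ?A"
      using keys_add[of v w] by auto
    then show ?thesis
      by (simp add: lin_ext_superset[of ?A] lookup_add poly_mapping_vs.scale_left_distrib
          sum.distrib)
  qed
  moreover have "lin_ext f (scale c v) = scale c (lin_ext f v)" for c v
    by (simp add: lin_ext_superset[of "Poly_Mapping.keys v"] keys_scale
        poly_mapping_vs.scale_sum_right)
  ultimately show ?thesis
    by unfold_locales auto
qed


global_interpretation poly_mapping_vsp: vector_space_pair
  "scale :: complex \<Rightarrow> ('a \<Rightarrow>\<^sub>0 complex) \<Rightarrow> _" "scale :: complex \<Rightarrow> ('b \<Rightarrow>\<^sub>0 complex) \<Rightarrow> _"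
  by unfold_locales

lemmas lin_ext_add = poly_mapping_vsp.linear_add[OF linear_lin_ext]
  and lin_ext_diff = poly_mapping_vsp.linear_diff[OF linear_lin_ext]
  and lin_ext_zero [simp] = poly_mapping_vsp.linear_0[OF linear_lin_ext]

lemma lin_ext_single [simp]: "lin_ext f (Poly_Mapping.single k c) = scale c (f k)"
  by (simp add: lin_ext_def)

lemma lin_ext_closed:
  assumes "poly_mapping_vs.subspace V" "\<And>k. k \<in> Poly_Mapping.keys v \<Longrightarrow> f k \<in> V"
  shows "lin_ext f v \<in> V"
  unfolding lin_ext_def using assms
  by (intro poly_mapping_vs.subspace_sum poly_mapping_vs.subspace_scale) auto

lemma linear_eq_lin_ext:
  assumes "Vector_Spaces.linear scale scale f"
  shows "f v = lin_ext (\<lambda>k. f (Poly_Mapping.single k 1)) v"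
proof (induction v rule: poly_mapping_induct_add)
  case zero
  show ?case using poly_mapping_vsp.linear_0[OF assms] by simp
next
  case (add k c v)
  have "Poly_Mapping.single k c = scale c (Poly_Mapping.single k 1)"
    by (auto intro!: poly_mapping_eqI simp: lookup_single when_def)
  then show ?case
    using add poly_mapping_vsp.linear_add[OF assms] poly_mapping_vsp.linear_scale[OF assms]
    by (simp add: lin_ext_add poly_mapping_vsp.linear_scale[OF linear_lin_ext])
qed

text \<open>Only basis vectors in the support of \<open>v\<close> are compared, so an identity known
  just for tableaux of size \<open>n\<close> extends to all vectors of
  \<open>SRCT_space n\<close>.\<close>

lemma linear_eq_on_keys:
  assumes "Vector_Spaces.linear scale scale f" "Vector_Spaces.linear scale scale g"
    and "\<And>k. k \<in> Poly_Mapping.keys v \<Longrightarrow> f (Poly_Mapping.single k 1) = g (Poly_Mapping.single k 1)"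
  shows "f v = g v"
  unfolding linear_eq_lin_ext[OF assms(1), of v] linear_eq_lin_ext[OF assms(2), of v]
  by (simp add: lin_ext_def assms(3))


section \<open>Hecke actions from operators satisfying the relations\<close>

locale hecke_operators =
  fixes n :: nat and V :: "('a \<Rightarrow>\<^sub>0 complex) set"
    and P :: "nat \<Rightarrow> ('a \<Rightarrow>\<^sub>0 complex) \<Rightarrow> ('a \<Rightarrow>\<^sub>0 complex)"
  assumes subspace: "poly_mapping_vs.subspace V"
    and linear_op: "Vector_Spaces.linear scale scale (P i)"
    and op_closed: "i \<in> {1..n - 1} \<Longrightarrow> v \<in> V \<Longrightarrow> P i v \<in> V"
    and op_idem: "i \<in> {1..n - 1} \<Longrightarrow> v \<in> V \<Longrightarrow> P i (P i v) = P i v"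
    and op_braid: "i \<in> {1..n - 2} \<Longrightarrow> v \<in> V \<Longrightarrow>
      P i (P (i + 1) (P i v)) = P (i + 1) (P i (P (i + 1) v))"
    and op_commute: "i \<in> {1..n - 1} \<Longrightarrow> j \<in> {1..n - 1} \<Longrightarrow> 2 \<le> \<bar>int i - int j\<bar> \<Longrightarrow>
      v \<in> V \<Longrightarrow> P i (P j v) = P j (P i v)"
begin

section \<open>Action of words and of the free algebra\<close>

definition word_op :: "word \<Rightarrow> ('a \<Rightarrow>\<^sub>0 complex) \<Rightarrow> ('a \<Rightarrow>\<^sub>0 complex)" where
  "word_op w = foldr P (letters w)"

definition free_op :: "(word \<Rightarrow>\<^sub>0 complex) \<Rightarrow> ('a \<Rightarrow>\<^sub>0 complex) \<Rightarrow> ('a \<Rightarrow>\<^sub>0 complex)" where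
  "free_op p v = lin_ext (\<lambda>w. word_op w v) p"

text \<open>With \<open>foldr\<close> the last letter acts first, so concatenation becomes
  composition and the result is a left action.\<close>

lemma word_op_plus: "word_op (u + w) v = word_op u (word_op w v)"
  by (simp add: word_op_def plus_word_def)

lemma word_op_zero [simp]: "word_op 0 v = v"
  by (simp add: word_op_def zero_word_def)

lemma linear_foldr: "Vector_Spaces.linear scale scale (foldr P xs)"
proof (induction xs)
  case Nil
  show ?case using poly_mapping_vs.linear_ident by (simp add: id_def)
next
  case (Cons i xs)
  show ?case using Vector_Spaces.linear_compose[OF Cons linear_op] by (simp add: comp_def)
qed

lemma linear_word_op: "Vector_Spaces.linear scale scale (word_op w)"
  unfolding word_op_def by (rule linear_foldr)

lemma word_op_closed:
  assumes "set (letters w) \<subseteq> {1..n - 1}" "v \<in> V"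
  shows "word_op w v \<in> V"
proof -
  have "set xs \<subseteq> {1..n - 1} \<Longrightarrow> foldr P xs v \<in> V" for xs
    using assms(2) by (induction xs) (auto intro!: op_closed)
  then show ?thesis using assms(1) by (simp add: word_op_def)
qed

lemma free_op_add_left: "free_op (p + q) v = free_op p v + free_op q v"
  and free_op_diff_left: "free_op (p - q) v = free_op p v - free_op q v"
  and free_op_zero_left: "free_op 0 v = 0"
  by (simp_all add: free_op_def lin_ext_add lin_ext_diff)

lemma free_op_single: "free_op (Poly_Mapping.single w c) v = scale c (word_op w v)"
  by (simp add: free_op_def)

lemma free_op_one: "free_op 1 v = v"
  using free_op_single[of 0 1 v] by simp

lemma free_op_gen: "free_op (gen i) v = P i v"
  by (simp add: gen_def free_op_single word_op_def)

lemma free_op_add_right: "free_op p (v + w) = free_op p v + free_op p w"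
  by (simp add: free_op_def lin_ext_def poly_mapping_vsp.linear_add[OF linear_word_op]
      poly_mapping_vs.scale_right_distrib sum.distrib)

lemma free_op_scale_right: "free_op p (scale c v) = scale c (free_op p v)"
  by (simp add: free_op_def lin_ext_def poly_mapping_vsp.linear_scale[OF linear_word_op]
      poly_mapping_vs.scale_sum_right mult.commute)

lemma free_op_zero_right: "free_op p 0 = 0"
  using free_op_add_right[of p 0 0] by simp

text \<open>Both sides are additive in \<open>p\<close> and in \<open>q\<close>, which reduces the
  claim to monomials, where it is \<open>word_op_plus\<close>.\<close>

lemma free_op_mult: "free_op (p * q) v = free_op p (free_op q v)"
proof (induction p rule: poly_mapping_induct_add)
  case zero
  show ?case by (simp add: free_op_zero_left)
next
  case (add u c p)
  have "free_op (Poly_Mapping.single u c * q) v = scale c (word_op u (free_op q v))"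
  proof (induction q rule: poly_mapping_induct_add)
    case zero
    show ?case
      by (simp add: free_op_zero_left poly_mapping_vsp.linear_0[OF linear_word_op])
  next
    case (add w d q)
    then show ?case
      by (simp add: distrib_left free_op_add_left mult_single free_op_single word_op_plus
          poly_mapping_vsp.linear_add[OF linear_word_op]
          poly_mapping_vsp.linear_scale[OF linear_word_op]
          poly_mapping_vs.scale_right_distrib)
  qed
  then show ?case
    by (simp add: distrib_right free_op_add_left add free_op_single)
qed

lemma free_op_closed:
  assumes "p \<in> carrier (free_algebra n)" "v \<in> V"
  shows "free_op p v \<in> V"
  unfolding free_op_def using assms
  by (intro lin_ext_closed subspace word_op_closed) (auto simp: free_algebra_def)

section \<open>The annihilator as a two-sided ideal\<close>

definition annihilator :: "(word \<Rightarrow>\<^sub>0 complex) set" where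
  "annihilator = {p \<in> carrier (free_algebra n). \<forall>v\<in>V. free_op p v = 0}"

text \<open>Left multiples annihilate because every operator sends 0 to 0; right multiples do
  because the free algebra maps \<open>V\<close> into itself.\<close>

lemma ideal_annihilator: "ideal annihilator (free_algebra n)"
proof (rule idealI[OF ring_free_algebra])
  interpret R: ring "free_algebra n" by (rule ring_free_algebra)
  \<comment> \<open>The additive inverse of the ring record is defined abstractly and has to be
    identified with the minus of the type.\<close>
  have inv: "\<ominus>\<^bsub>free_algebra n\<^esub> p = - p" if "p \<in> carrier (free_algebra n)" for p
    using that by (intro R.minus_equality) (auto simp: free_algebra_def in_keys_iff)
  show "subgroup annihilator (add_monoid (free_algebra n))"
  proof (rule R.add.subgroupI)
    fix p assume p: "p \<in> annihilator"
    then have "p \<in> carrier (free_algebra n)" "\<And>v. v \<in> V \<Longrightarrow> free_op p v = 0"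
      by (auto simp: annihilator_def)
    then show "\<ominus>\<^bsub>free_algebra n\<^esub> p \<in> annihilator"
      using R.a_inv_closed[of p] inv[of p] free_op_diff_left[of 0 p]
      by (simp add: annihilator_def free_op_zero_left)
  next
    fix p q assume "p \<in> annihilator" "q \<in> annihilator"
    then show "p \<oplus>\<^bsub>free_algebra n\<^esub> q \<in> annihilator"
      using R.a_closed[of p q] by (simp add: annihilator_def free_algebra_def free_op_add_left)
  next
    have "0 \<in> annihilator"
      using R.zero_closed by (simp add: annihilator_def free_op_zero_left) (simp add: free_algebra_def)
    then show "annihilator \<noteq> {}" by blast
  qed (auto simp: annihilator_def)
next
  interpret R: ring "free_algebra n" by (rule ring_free_algebra)
  fix p q assume pq: "p \<in> annihilator" "q \<in> carrier (free_algebra n)"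
  have mult: "a \<otimes>\<^bsub>free_algebra n\<^esub> b = a * b" for a b
    by (simp add: free_algebra_def)
  show "q \<otimes>\<^bsub>free_algebra n\<^esub> p \<in> annihilator" "p \<otimes>\<^bsub>free_algebra n\<^esub> q \<in> annihilator"
    using pq R.m_closed[of p q] R.m_closed[of q p]
    by (auto simp: annihilator_def mult free_op_mult free_op_zero_right free_op_closed)
qed

lemma hecke_relators_annihilate: "hecke_relators n \<subseteq> annihilator"
proof
  fix p assume p: "p \<in> hecke_relators n"
  have "free_op p v = 0" if v: "v \<in> V" for v
    using p v op_closed op_idem op_braid op_commute
    unfolding hecke_relators_def
    by (auto simp: free_op_diff_left free_op_mult free_op_gen)
  then show "p \<in> annihilator"
    using p hecke_relators_subset by (auto simp: annihilator_def)
qed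

lemma hecke_ideal_annihilates:
  assumes "p \<in> hecke_ideal n" "v \<in> V"
  shows "free_op p v = 0"
proof -
  have "hecke_ideal n \<subseteq> annihilator"
    unfolding hecke_ideal_def
    by (rule ring.genideal_minimal[OF ring_free_algebra ideal_annihilator
          hecke_relators_annihilate])
  then show ?thesis using assms by (auto simp: annihilator_def)
qed

section \<open>Passage to the quotient\<close>

definition hecke_op ::
  "(word \<Rightarrow>\<^sub>0 complex) set \<Rightarrow> ('a \<Rightarrow>\<^sub>0 complex) \<Rightarrow> ('a \<Rightarrow>\<^sub>0 complex)" where
  "hecke_op h = free_op (SOME p. p \<in> h)"

text \<open>The chosen representative of the coset differs from \<open>p\<close> by an element of
  the ideal, and such elements annihilate \<open>V\<close>; hence the choice does not matter on
  \<open>V\<close>.\<close>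

lemma hecke_op_class:
  assumes "v \<in> V"
  shows "hecke_op (hecke_class n p) v = free_op p v"
proof -
  have class_eq: "hecke_class n p = {q + p | q. q \<in> hecke_ideal n}"
    by (auto simp: hecke_class_def a_r_coset_def' free_algebra_def)
  \<comment> \<open>This makes the coset nonempty, so that \<open>SOME\<close> returns one of its
    elements.\<close>
  have "0 \<in> hecke_ideal n"
    using additive_subgroup.zero_closed[OF ideal.axioms(1)[OF ideal_hecke_ideal[of n]]]
    by (simp add: free_algebra_def)
  then have "\<exists>q. q \<in> hecke_class n p"
    unfolding class_eq by blast
  then have "(SOME q. q \<in> hecke_class n p) \<in> hecke_class n p"
    by (rule someI_ex)
  then obtain q where "q \<in> hecke_ideal n" "(SOME q. q \<in> hecke_class n p) = q + p"
    unfolding class_eq by blast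
  then show ?thesis
    using assms by (simp add: hecke_op_def free_op_add_left hecke_ideal_annihilates)
qed

lemma carrier_Hecke: "carrier (Hecke n) = hecke_class n ` carrier (free_algebra n)"
  by (auto simp: Hecke_def FactRing_def A_RCOSETS_def' hecke_class_def)

lemma hecke_action_hecke_op: "hecke_action n V hecke_op"
proof -
  interpret I: ideal "hecke_ideal n" "free_algebra n" by (rule ideal_hecke_ideal)
  interpret H: ring_hom_ring "free_algebra n" "Hecke n" "hecke_class n"
    using I.rcos_ring_hom_ring unfolding Hecke_def hecke_class_def[abs_def] by simp
  have ops: "a \<oplus>\<^bsub>free_algebra n\<^esub> b = a + b" "a \<otimes>\<^bsub>free_algebra n\<^esub> b = a * b" "\<one>\<^bsub>free_algebra n\<^esub> = 1" for a b
    by (simp_all add: free_algebra_def)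
  have scale: "v \<in> V \<Longrightarrow> scale c v \<in> V" and add: "v \<in> V \<Longrightarrow> w \<in> V \<Longrightarrow> v + w \<in> V" for c v w
    using subspace by (auto simp: poly_mapping_vs.subspace_def)
  show ?thesis
    unfolding hecke_action_def carrier_Hecke
    \<comment> \<open>The homomorphism rules are used from right to left: sums and products of
      classes are merged into a single class, to which \<open>hecke_op_class\<close>
      applies.\<close>
    by (auto simp: hecke_op_class free_op_closed free_op_add_right free_op_scale_right scale add
        H.hom_add[symmetric] H.hom_mult[symmetric] H.hom_one[symmetric] ops
        free_op_add_left free_op_mult hecke_const_def free_op_single free_op_one
        simp del: H.hom_add H.hom_mult H.hom_one)
qed

lemma hecke_op_T: "v \<in> V \<Longrightarrow> hecke_op (hecke_T n i) v = P i v"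
  by (simp add: hecke_T_def hecke_op_class free_op_gen)

end


section \<open>Swapping consecutive entries of a tableau\<close>

lemma shape_swap [simp]: "shape (swap_entries i \<tau>) = shape \<tau>"
  by (simp add: shape_def swap_entries_def)

lemma entry_swap:
  "c \<in> diagram (shape \<tau>) \<Longrightarrow>
    entry (swap_entries i \<tau>) c = Transposition.transpose i (i + 1) (entry \<tau> c)"
  by (auto simp: entry_def swap_entries_def diagram_def shape_def)

text \<open>The descriptions defining the two inverse values hold for exactly the same cells, so the
  equation needs neither injectivity nor that \<open>x\<close> is an entry.\<close>

lemma cell_of_swap:
  "cell_of (swap_entries i \<tau>) x = cell_of \<tau> (Transposition.transpose i (i + 1) x)"
proof -
  have "c \<in> diagram (shape \<tau>) \<and> entry (swap_entries i \<tau>) c = x \<longleftrightarrow>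
      c \<in> diagram (shape \<tau>) \<and> entry \<tau> c = Transposition.transpose i (i + 1) x" for c
    using entry_swap[of c \<tau> i] by (auto simp: transpose_eq_iff)
  then show ?thesis
    by (simp add: cell_of_def the_inv_into_def)
qed

lemma col_of_swap:
  "col_of (swap_entries i \<tau>) x = col_of \<tau> (Transposition.transpose i (i + 1) x)"
  by (simp add: col_of_def cell_of_swap)

lemma row_of_swap:
  "row_of (swap_entries i \<tau>) x = row_of \<tau> (Transposition.transpose i (i + 1) x)"
  by (simp add: row_of_def cell_of_swap)

text \<open>No natural number lies between \<open>i\<close> and \<open>i + 1\<close>, so exchanging
  them reverses no other comparison.\<close>

lemma transpose_less:
  fixes a b i :: nat
  assumes "a < b" "\<not> (a = i \<and> b = i + 1)"
  shows "Transposition.transpose i (i + 1) a < Transposition.transpose i (i + 1) b"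
  using assms by (auto simp: Transposition.transpose_def)

text \<open>
  Only the comparison between \<open>i\<close> and \<open>i + 1\<close> is affected by the swap. For a non-attacking
  descent, these entries lie neither in one row, nor in one column, nor at the two cells of the
  hypothesis of the triple rule.
\<close>

lemma swap_entries_SRCT:
  assumes \<tau>: "\<tau> \<in> SRCT \<alpha>" and des: "i \<in> Des \<tau>" and nonatt: "\<not> attacking \<tau> i"
  shows "swap_entries i \<tau> \<in> SRCT \<alpha>"
proof -
  let ?t = "Transposition.transpose i (i + 1)"
  let ?\<tau> = "swap_entries i \<tau>"
  have sh: "shape \<tau> = \<alpha>" and bij: "bij_betw (entry \<tau>) (diagram \<alpha>) {1..sum_list \<alpha>}"
    and row: "\<And>r j k. (r, j) \<in> diagram \<alpha> \<Longrightarrow> (r, k) \<in> diagram \<alpha> \<Longrightarrow> j < k \<Longrightarrow>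
      entry \<tau> (r, k) < entry \<tau> (r, j)"
    and col: "\<And>r s. (r, 0) \<in> diagram \<alpha> \<Longrightarrow> (s, 0) \<in> diagram \<alpha> \<Longrightarrow> r < s \<Longrightarrow>
      entry \<tau> (r, 0) < entry \<tau> (s, 0)"
    and triple: "\<And>r s k. (r, k) \<in> diagram \<alpha> \<Longrightarrow> (s, Suc k) \<in> diagram \<alpha> \<Longrightarrow> r < s \<Longrightarrow>
      entry \<tau> (s, Suc k) < entry \<tau> (r, k) \<Longrightarrow>
      (r, Suc k) \<in> diagram \<alpha> \<and> entry \<tau> (s, Suc k) < entry \<tau> (r, Suc k)"
    using \<tau> unfolding SRCT_def by blast+
  have cell: "cell_of \<tau> (entry \<tau> c) = c" if "c \<in> diagram \<alpha>" for c
    using that bij unfolding cell_of_def sh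
    by (intro the_inv_into_f_f) (auto simp: bij_betw_def)
  have entry: "entry ?\<tau> c = ?t (entry \<tau> c)" if "c \<in> diagram \<alpha>" for c
    using that sh by (simp add: entry_swap)
  \<comment> \<open>A descent gives \<open>k \<le> l\<close>. Being non-attacking excludes equal
    columns and the adjacent column strictly southeast.\<close>
  have pos: "k < l \<and> \<not> (l = Suc k \<and> r < s)"
    if "(r, k) \<in> diagram \<alpha>" "(s, l) \<in> diagram \<alpha>" "entry \<tau> (r, k) = i" "entry \<tau> (s, l) = i + 1"
    for r s k l
    using cell[OF that(1)] cell[OF that(2)] that(3,4) des nonatt
    by (auto simp: Des_def attacking_def col_of_def row_of_def)
  have i: "i \<in> {1..sum_list \<alpha>}" "i + 1 \<in> {1..sum_list \<alpha>}"
    using des sh by (auto simp: Des_def)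
  have "bij_betw (?t \<circ> entry \<tau>) (diagram \<alpha>) {1..sum_list \<alpha>}"
    by (rule bij_betw_trans[OF bij]) (use i in \<open>auto simp: bij_betw_transpose_iff\<close>)
  then have "bij_betw (entry ?\<tau>) (diagram \<alpha>) {1..sum_list \<alpha>}"
    by (rule iffD1[OF bij_betw_cong, rotated]) (simp add: entry)
  moreover have "entry ?\<tau> (r, k) < entry ?\<tau> (r, j)"
    if "(r, j) \<in> diagram \<alpha>" "(r, k) \<in> diagram \<alpha>" "j < k" for r j k
    unfolding entry[OF that(1)] entry[OF that(2)]
    using row[OF that] pos[OF that(2) that(1)] that(3) by (intro transpose_less) auto
  moreover have "entry ?\<tau> (r, 0) < entry ?\<tau> (s, 0)"
    if "(r, 0) \<in> diagram \<alpha>" "(s, 0) \<in> diagram \<alpha>" "r < s" for r s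
    unfolding entry[OF that(1)] entry[OF that(2)]
    using col[OF that] pos[OF that(1) that(2)] by (intro transpose_less) auto
  moreover have "(r, Suc k) \<in> diagram \<alpha> \<and> entry ?\<tau> (s, Suc k) < entry ?\<tau> (r, Suc k)"
    if "(r, k) \<in> diagram \<alpha>" "(s, Suc k) \<in> diagram \<alpha>" "r < s"
      "entry ?\<tau> (s, Suc k) < entry ?\<tau> (r, k)" for r s k
  proof -
    \<comment> \<open>The transposition is an involution, so the hypothesis is carried back to
      \<open>\<tau>\<close> by applying it once more. The exceptional pair would put
      \<open>i + 1\<close> strictly southeast of \<open>i\<close> in the next column.\<close>
    have "\<not> (entry ?\<tau> (s, Suc k) = i \<and> entry ?\<tau> (r, k) = i + 1)"
      unfolding entry[OF that(1)] entry[OF that(2)] transpose_eq_iff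
      using that(3) pos[OF that(1,2)] by fastforce
    from transpose_less[OF that(4) this] have lt: "entry \<tau> (s, Suc k) < entry \<tau> (r, k)"
      unfolding entry[OF that(1)] entry[OF that(2)] by simp
    have M: "(r, Suc k) \<in> diagram \<alpha>" "entry \<tau> (s, Suc k) < entry \<tau> (r, Suc k)"
      using triple[OF that(1-3) lt] by auto
    \<comment> \<open>Here the exceptional pair would place \<open>i\<close> and
      \<open>i + 1\<close> in the same column.\<close>
    have "entry ?\<tau> (s, Suc k) < entry ?\<tau> (r, Suc k)"
      unfolding entry[OF that(2)] entry[OF M(1)]
      using M(2) pos[OF that(2) M(1)] by (intro transpose_less) auto
    then show ?thesis using M(1) by blast
  qed
  ultimately show ?thesis
    unfolding SRCT_def mem_Collect_eq shape_swap sh by blast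
qed

lemma SRCTs_size: "\<tau> \<in> SRCTs n \<Longrightarrow> sum_list (shape \<tau>) = n"
  by (auto simp: SRCTs_def SRCT_def compositions_def)

lemma swap_entries_SRCTs:
  "\<tau> \<in> SRCTs n \<Longrightarrow> i \<in> Des \<tau> \<Longrightarrow> \<not> attacking \<tau> i \<Longrightarrow> swap_entries i \<tau> \<in> SRCTs n"
  unfolding SRCTs_def using swap_entries_SRCT by blast


section \<open>Relations between the operators\<close>

lemma pi_op_eq_lin_ext: "pi_op i = lin_ext (pi_basis i)"
  by (simp add: fun_eq_iff pi_op_def lin_ext_def)

lemma linear_pi_op: "Vector_Spaces.linear scale scale (pi_op i)"
  unfolding pi_op_eq_lin_ext by (rule linear_lin_ext)

lemma pi_op_zero [simp]: "pi_op i 0 = 0"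
  by (simp add: pi_op_eq_lin_ext)

lemma pi_op_single [simp]: "pi_op i (Poly_Mapping.single \<tau> 1) = pi_basis i \<tau>"
  by (simp add: pi_op_eq_lin_ext)

text \<open>For an index in range, being a descent is a mere comparison of columns; this form can be
  rewritten with \<open>col_of_swap\<close> and \<open>row_of_swap\<close>.\<close>

lemma pi_basis_cases:
  assumes "sum_list (shape \<tau>) = n" "i \<in> {1..n - 1}"
  shows "pi_basis i \<tau> =
     (if col_of \<tau> (i + 1) < col_of \<tau> i then Poly_Mapping.single \<tau> 1
      else if col_of \<tau> i = col_of \<tau> (i + 1) \<or>
        (col_of \<tau> (i + 1) = col_of \<tau> i + 1 \<and> row_of \<tau> i < row_of \<tau> (i + 1)) then 0
      else Poly_Mapping.single (swap_entries i \<tau>) 1)"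
  using assms by (auto simp: pi_basis_def Des_def attacking_def)

text \<open>After a swap at a non-attacking descent, \<open>i + 1\<close> lies strictly left of
  \<open>i\<close>, so the second application fixes the filling.\<close>

lemma pi_basis_idem:
  assumes "sum_list (shape \<tau>) = n" "i \<in> {1..n - 1}"
  shows "pi_op i (pi_basis i \<tau>) = pi_basis i \<tau>"
  using assms
  by (auto simp: pi_basis_cases col_of_swap row_of_swap)

lemma swap_entries_commute:
  assumes "2 \<le> \<bar>int i - int j\<bar>"
  shows "swap_entries i (swap_entries j \<tau>) = swap_entries j (swap_entries i \<tau>)"
  using assms by (auto simp: swap_entries_def Transposition.transpose_def)

text \<open>Each swap fixes both entries that the other operator compares, so its case is decided by
  the original filling.\<close>

lemma pi_basis_commute:
  assumes "sum_list (shape \<tau>) = n" "i \<in> {1..n - 1}" "j \<in> {1..n - 1}" "2 \<le> \<bar>int i - int j\<bar>"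
  shows "pi_op i (pi_basis j \<tau>) = pi_op j (pi_basis i \<tau>)"
proof -
  have "i \<noteq> j" "i \<noteq> j + 1" "j \<noteq> i + 1"
    using assms(4) by auto
  then have "Transposition.transpose i (i + 1) j = j"
    "Transposition.transpose i (i + 1) (j + 1) = j + 1"
    "Transposition.transpose j (j + 1) i = i"
    "Transposition.transpose j (j + 1) (i + 1) = i + 1"
    by (auto simp: Transposition.transpose_def)
  with assms show ?thesis
    by (simp add: pi_basis_cases col_of_swap row_of_swap swap_entries_commute)
qed

lemma swap_entries_braid:
  "swap_entries i (swap_entries (i + 1) (swap_entries i \<tau>)) =
    swap_entries (i + 1) (swap_entries i (swap_entries (i + 1) \<tau>))"
  by (auto simp: swap_entries_def Transposition.transpose_def)

text \<open>
  Both sides compare the entries at the three pairs of original cells of \<open>i\<close>, \<open>i + 1\<close>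
  and \<open>i + 2\<close>, in opposite orders. They sort the entries by column in the same way unless an
  attacking pair is met, and then both vanish.
\<close>

lemma pi_basis_braid:
  assumes "sum_list (shape \<tau>) = n" "i \<in> {1..n - 2}"
  shows "pi_op i (pi_op (i + 1) (pi_basis i \<tau>)) = pi_op (i + 1) (pi_op i (pi_basis (i + 1) \<tau>))"
proof -
  have i: "i \<in> {1..n - 1}" "i + 1 \<in> {1..n - 1}"
    using assms(2) by auto
  \<comment> \<open>The index is left as \<open>i + 1 + 1\<close>, the form in which the case rule
    at \<open>i + 1\<close> yields it, since the rewriting below matches it literally.\<close>
  have t: "Transposition.transpose i (i + 1) i = i + 1"
    "Transposition.transpose i (i + 1) (i + 1) = i"
    "Transposition.transpose i (i + 1) (i + 1 + 1) = i + 1 + 1"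
    "Transposition.transpose (i + 1) (i + 1 + 1) i = i"
    "Transposition.transpose (i + 1) (i + 1 + 1) (i + 1) = i + 1 + 1"
    "Transposition.transpose (i + 1) (i + 1 + 1) (i + 1 + 1) = i + 1"
    by (auto simp: Transposition.transpose_def)
  \<comment> \<open>Here \<open>p\<close> and \<open>q\<close> name cells by their entries in the
    original \<open>\<tau>\<close>: \<open>N\<close> says that the pair is already sorted,
    \<open>A\<close> is the attacking condition.\<close>
  define N where "N p q \<longleftrightarrow> col_of \<tau> q < col_of \<tau> p" for p q
  define A where "A p q \<longleftrightarrow> col_of \<tau> p = col_of \<tau> q \<or>
    (col_of \<tau> q = col_of \<tau> p + 1 \<and> row_of \<tau> p < row_of \<tau> q)" for p q
  define j where "j = i + 1"
  define k where "k = i + 1 + 1"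
  let ?s = "\<lambda>\<sigma>. Poly_Mapping.single \<sigma> (1 :: complex)"
  let ?i = "swap_entries i" and ?j = "swap_entries j"
  note basis = pi_basis_cases[of _ n] col_of_swap row_of_swap shape_swap assms(1) i t
  \<comment> \<open>Each comparison after some swaps is traced back to original cells. For instance,
    \<open>i\<close> and \<open>i + 1\<close> in \<open>?j \<tau>\<close> occupy the original cells
    of \<open>i\<close> and \<open>k\<close>.\<close>
  have e:
    "pi_basis i \<tau> = (if N i j then ?s \<tau> else if A i j then 0 else ?s (?i \<tau>))"
    "pi_basis j \<tau> = (if N j k then ?s \<tau> else if A j k then 0 else ?s (?j \<tau>))"
    "pi_basis j (?i \<tau>) = (if N i k then ?s (?i \<tau>) else if A i k then 0 else ?s (?j (?i \<tau>)))"
    "pi_basis i (?j \<tau>) = (if N i k then ?s (?j \<tau>) else if A i k then 0 else ?s (?i (?j \<tau>)))"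
    "pi_basis i (?j (?i \<tau>)) =
      (if N j k then ?s (?j (?i \<tau>)) else if A j k then 0 else ?s (?i (?j (?i \<tau>))))"
    "pi_basis j (?i (?j \<tau>)) =
      (if N i j then ?s (?i (?j \<tau>)) else if A i j then 0 else ?s (?j (?i (?j \<tau>))))"
    unfolding N_def A_def j_def k_def by (simp_all only: basis)
  \<comment> \<open>These cover the words whose middle operator acts as the identity, so that the
    same operator meets its own swap again.\<close>
  have stay: "N j i \<Longrightarrow> pi_basis i (?i \<tau>) = ?s (?i \<tau>)" "N k j \<Longrightarrow> pi_basis j (?j \<tau>) = ?s (?j \<tau>)"
    unfolding N_def j_def k_def by (simp_all only: basis if_True)
  have braid: "?i (?j (?i \<tau>)) = ?j (?i (?j \<tau>))"
    unfolding j_def by (rule swap_entries_braid)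
  \<comment> \<open>The last fact is the decisive one: two strict moves to the right put
    \<open>k\<close> at least two columns beyond \<open>i\<close>, too far to attack.\<close>
  have "N i j \<Longrightarrow> N j k \<Longrightarrow> N i k" "\<not> N i j \<Longrightarrow> \<not> A i j \<Longrightarrow> N j i"
    "\<not> N j k \<Longrightarrow> \<not> A j k \<Longrightarrow> N k j" "\<not> N i j \<Longrightarrow> \<not> N j k \<Longrightarrow> \<not> N i k"
    "\<not> N i j \<Longrightarrow> \<not> A i j \<Longrightarrow> \<not> N j k \<Longrightarrow> \<not> A j k \<Longrightarrow> \<not> A i k"
    unfolding N_def A_def by linarith+
  then show ?thesis
    unfolding j_def[symmetric]
    by (cases "N i j"; cases "A i j"; cases "N j k"; cases "A j k"; cases "N i k"; cases "A i k")
      (simp_all add: e stay braid)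
qed

section \<open>The operators on the span of the tableaux\<close>

lemma subspace_SRCT_space: "poly_mapping_vs.subspace (SRCT_space n)"
  unfolding poly_mapping_vs.subspace_def SRCT_space_def
  by (auto dest!: subsetD[OF keys_add] subsetD[OF keys_scale])

lemma pi_basis_closed: "\<tau> \<in> SRCTs n \<Longrightarrow> pi_basis i \<tau> \<in> SRCT_space n"
  by (auto simp: pi_basis_def SRCT_space_def swap_entries_SRCTs)

lemma pi_op_closed: "v \<in> SRCT_space n \<Longrightarrow> pi_op i v \<in> SRCT_space n"
  unfolding pi_op_eq_lin_ext
  by (intro lin_ext_closed subspace_SRCT_space pi_basis_closed) (auto simp: SRCT_space_def)

lemma hecke_operators_pi_op: "hecke_operators n (SRCT_space n) pi_op"
proof (rule hecke_operators.intro)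
  fix i j v
  assume "v \<in> SRCT_space n"
  then have size: "\<tau> \<in> Poly_Mapping.keys v \<Longrightarrow> sum_list (shape \<tau>) = n" for \<tau>
    by (auto simp: SRCT_space_def SRCTs_size)
  \<comment> \<open>Both sides of each relation are linear, so the relations on single tableaux
    carry over to \<open>v\<close>.\<close>
  note linear2 = Vector_Spaces.linear_compose[OF linear_pi_op linear_pi_op, unfolded comp_def]
  note linear3 = Vector_Spaces.linear_compose[OF linear2 linear_pi_op, unfolded comp_def]
  show "pi_op i (pi_op i v) = pi_op i v" if "i \<in> {1..n - 1}"
    by (rule linear_eq_on_keys[OF linear2 linear_pi_op])
      (simp only: pi_op_single pi_basis_idem[OF size that])
  show "pi_op i (pi_op (i + 1) (pi_op i v)) = pi_op (i + 1) (pi_op i (pi_op (i + 1) v))"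
    if "i \<in> {1..n - 2}"
    by (rule linear_eq_on_keys[OF linear3 linear3])
      (simp only: pi_op_single pi_basis_braid[OF size that])
  show "pi_op i (pi_op j v) = pi_op j (pi_op i v)"
    if "i \<in> {1..n - 1}" "j \<in> {1..n - 1}" "2 \<le> \<bar>int i - int j\<bar>"
    by (rule linear_eq_on_keys[OF linear2 linear2])
      (simp only: pi_op_single pi_basis_commute[OF size that])
qed (use subspace_SRCT_space linear_pi_op pi_op_closed in \<open>blast+\<close>)

theorem theorem3p2:
  fixes n :: nat
  assumes "1 \<le> n"
  shows "(\<forall>i\<in>{1..n - 1}. \<forall>v\<in>SRCT_space n. pi_op i v \<in> SRCT_space n) \<and>
    (\<forall>i\<in>{1..n - 1}. \<forall>v\<in>SRCT_space n. pi_op i (pi_op i v) = pi_op i v) \<and>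
    (\<forall>i\<in>{1..n - 2}. \<forall>v\<in>SRCT_space n.
       pi_op i (pi_op (i + 1) (pi_op i v)) = pi_op (i + 1) (pi_op i (pi_op (i + 1) v))) \<and>
    (\<forall>i\<in>{1..n - 1}. \<forall>j\<in>{1..n - 1}. 2 \<le> \<bar>int i - int j\<bar> \<longrightarrow>
       (\<forall>v\<in>SRCT_space n. pi_op i (pi_op j v) = pi_op j (pi_op i v))) \<and>
    (\<exists>act. hecke_action n (SRCT_space n) act \<and>
       (\<forall>i\<in>{1..n - 1}. \<forall>v\<in>SRCT_space n. act (hecke_T n i) v = pi_op i v))"
proof -
  interpret hecke_operators n "SRCT_space n" pi_op
    by (rule hecke_operators_pi_op)
  show ?thesis
    using op_closed op_idem op_braid op_commute hecke_action_hecke_op hecke_op_T by blast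
qed

end
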